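(* Let $k=(k_1,k_2)\in\mathbb{C}^2$, $\gamma_+,\gamma_-\in\mathbb{C}$, and consider the matrix differential operators $$\widehat{G}_\pm(k)=\begin{pmatrix} G_\pm(k_+) & 0\\ 0& G_\pm(k_-)\end{pmatrix},\quad \widehat{E}_+(k;\gamma_+)=\begin{pmatrix} E_+(k_+) & 0\\ \gamma_+ & E_+(k_-)\end{pmatrix},\quad \widehat{E}_-(k;\gamma_-)=\begin{pmatrix} E_-(k_+) & \gamma_-\\ 0& E_-(k_-)\end{pmatrix}.$$ Then $\widehat{G}_+(k)$ and $\widehat{G}_-(k)$ are $\mathfrak{D}_k$-shift operators with shifts $(0,1)$ and $(0,-1)$, respectively. Moreover, $\widehat{E}_+(k;\gamma_+)$ is a $\mathfrak{D}_k$-shift operator with shift $(2,-1)$ if and only if $\gamma_+=-1$, and $\widehat{E}_-(k;\gamma_-)$ is a $\mathfrak{D}_k$-shift operator with shift $(-2,1)$ if and only if $\gamma_-=-1$.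
   Context: Let $\mathbb{C}[z^{\pm1}]$ be the Laurent polynomials, $\Delta=z-z^{-1}$, and $\mathbb{C}_\Delta[z^{\pm}]$ the localization of $\mathbb{C}[z^{\pm1}]$ at $\Delta$. Put $x=(z+z^{-1})/2$, so $\mathbb{C}[x]\subset\mathbb{C}[z^{\pm1}]$ is the ring of invariants under $z\mapsto z^{-1}$. $\mathbb{M}_2$ is the algebra of complex $2\times2$ matrices and $\mathbb{M}_2[x]=\mathbb{C}[x]\otimes\mathbb{M}_2$. For a parameter $k=(k_1,k_2)$ define the scalar operators $$G_+(k)=\frac{1}{z-z^{-1}}z\partial_z,\qquad G_-(k)=(z-z^{-1})z\partial_z+(k_1+2k_2-1)(z+z^{-1})+2k_1,$$ $$E_+(k)=\frac{1+z^{-1}}{1-z^{-1}}z\partial_z+k_2-\tfrac12,\qquad E_-(k)=\frac{1-z^{-1}}{1+z^{-1}}z\partial_z+k_1+k_2-\tfrac12.$$ Put $k_+=k+(1,0)$, $k_-=k+(-1,1)$ and $$\mathfrak{D}_k=\begin{pmatrix}\frac12(1-k_1) & -E_+(k_-)\\ -E_-(k_+) & \frac12(1+k_1)\end{pmatrix}.$$ An element $\widehat{S}(k)\in\mathbb{C}_\Delta[z^\pm]\otimes\mathbb{C}[z\partial_z]\otimes\mathbb{M}_2$ is called a $\mathfrak{D}_k$-shift operator with shift $\ell$ if (i) $\widehat{S}(k)\mathfrak{D}_k=\mathfrak{D}_{k+\ell}\widehat{S}(k)$, and (ii) $\widehat{S}(k)$ acts as a matrix-valued differential operator on $\mathbb{M}_2[x]$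 (i.e. maps $\mathbb{M}_2[x]$ to itself). *)

theory Defs
  imports "HOL-Analysis.Analysis" "HOL-Computational_Algebra.Computational_Algebra"
begin

section \<open>Laurent polynomials and the localization at \<open>z - 1/z\<close>\<close>

text \<open>
  The rings involved are integral domains, and all of them are realized inside the field
  \<open>complex fls\<close> of formal Laurent series in \<open>z\<close> (a rational function is identified with its
  expansion at \<open>z = 0\<close>).  In particular the localization is the subring of all \<open>p / \<Delta>^n\<close>.
\<close>

abbreviation Z :: "complex fls" where
  "Z \<equiv> fls_X"

definition Delta :: "complex fls" where
  "Delta = Z - inverse Z"

definition laurent_polys :: "complex fls set" where
  "laurent_polys = {f. finite {n. fls_nth f n \<noteq> 0}}"

definition laurent_polys_loc :: "complex fls set" where
  "laurent_polys_loc = {p / Delta ^ n | p n. p \<in> laurent_polys}"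

definition x_elem :: "complex fls" where
  "x_elem = (Z + inverse Z) / 2"

definition polys_in_x :: "complex fls set" where
  "polys_in_x = range (\<lambda>p :: complex poly. poly (map_poly fls_const p) x_elem)"

definition zderiv :: "complex fls \<Rightarrow> complex fls" where
  "zderiv f = Z * fls_deriv f"


section \<open>Differential operators\<close>

text \<open>
  An operator \<open>\<Sum>i. a\<^sub>i (z\<partial>\<^sub>z)^i\<close> is the formal polynomial with coefficients \<open>a\<^sub>i\<close>, written to the
  left of the powers of \<open>z\<partial>\<^sub>z\<close>.  The product is determined by \<open>(z\<partial>\<^sub>z) a = a (z\<partial>\<^sub>z) + zderiv a\<close>.
  Coefficients range over the whole field here; \<open>diffops_loc\<close> below is the subalgebra with
  coefficients in the localization.
\<close>

typedef diffop = "UNIV :: complex fls poly set"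
  morphisms op_poly Diffop ..

setup_lifting type_definition_diffop

text \<open>Left multiplication of a formal operator by \<open>z\<partial>\<^sub>z\<close>.\<close>

definition theta_left :: "complex fls poly \<Rightarrow> complex fls poly" where
  "theta_left q = pCons 0 q + map_poly zderiv q"

definition op_mult :: "complex fls poly \<Rightarrow> complex fls poly \<Rightarrow> complex fls poly" where
  "op_mult p q = (\<Sum>i\<le>degree p. smult (coeff p i) ((theta_left ^^ i) q))"

lemma zderiv_0 [simp]: "zderiv 0 = 0"
  and zderiv_1 [simp]: "zderiv 1 = 0"
  and zderiv_add: "zderiv (f + g) = zderiv f + zderiv g"
  and zderiv_mult: "zderiv (f * g) = f * zderiv g + zderiv f * g"
  by (simp_all add: zderiv_def algebra_simps)

lemma theta_left_0 [simp]: "theta_left 0 = 0"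
  by (simp add: theta_left_def)

lemma theta_left_add: "theta_left (p + q) = theta_left p + theta_left q"
proof -
  have "map_poly zderiv (p + q) = map_poly zderiv p + map_poly zderiv q"
    by (rule poly_eqI) (simp add: coeff_map_poly zderiv_add)
  then show ?thesis
    by (simp add: theta_left_def)
qed

lemma theta_left_smult: "theta_left (smult a q) = smult a (theta_left q) + smult (zderiv a) q"
proof -
  have "map_poly zderiv (smult a q) = smult a (map_poly zderiv q) + smult (zderiv a) q"
    by (rule poly_eqI) (simp add: coeff_map_poly zderiv_mult)
  then show ?thesis
    by (simp add: theta_left_def smult_add_right)
qed

lemma theta_left_pow_add: "(theta_left ^^ i) (p + q) = (theta_left ^^ i) p + (theta_left ^^ i) q"
  by (induction i) (simp_all add: theta_left_add)

lemma theta_left_pow_0 [simp]: "(theta_left ^^ i) 0 = 0"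
  by (induction i) simp_all

lemma theta_left_pow_1: "(theta_left ^^ i) 1 = monom 1 i"
proof (induction i)
  case (Suc i)
  have "map_poly zderiv (monom 1 i) = 0"
    by (rule poly_eqI) (simp add: coeff_map_poly)
  with Suc show ?case
    by (simp add: theta_left_def monom_Suc)
qed (simp add: monom_0 one_pCons)

lemma op_mult_bound:
  assumes "degree p \<le> n"
  shows "op_mult p q = (\<Sum>i\<le>n. smult (coeff p i) ((theta_left ^^ i) q))"
  unfolding op_mult_def
  by (rule sum.mono_neutral_left) (use assms in \<open>auto simp: coeff_eq_0\<close>)

lemma op_mult_add_left: "op_mult (p + p') q = op_mult p q + op_mult p' q"
proof -
  define n where "n = max (degree p) (degree p')"
  have "degree (p + p') \<le> n" "degree p \<le> n" "degree p' \<le> n"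
    by (auto simp: n_def degree_add_le)
  then show ?thesis
    by (simp add: op_mult_bound smult_add_left sum.distrib)
qed

lemma op_mult_add_right: "op_mult p (q + q') = op_mult p q + op_mult p q'"
  by (simp add: op_mult_def theta_left_pow_add smult_add_right sum.distrib)

lemma op_mult_0_left [simp]: "op_mult 0 q = 0"
  by (simp add: op_mult_def)

lemma op_mult_0_right [simp]: "op_mult p 0 = 0"
  by (simp add: op_mult_def)

lemma op_mult_smult: "op_mult (smult a p) q = smult a (op_mult p q)"
proof -
  have "smult a (sum f A) = (\<Sum>i\<in>A. smult a (f i))" for f :: "nat \<Rightarrow> complex fls poly" and A
    by (induction A rule: infinite_finite_induct) (simp_all add: smult_add_right)
  then show ?thesis
    using degree_smult_le [of a p] by (simp add: op_mult_bound [of _ "degree p"])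
qed

lemma op_mult_pCons: "op_mult (pCons a p) q = smult a q + op_mult p (theta_left q)"
proof -
  have "degree (pCons a p) \<le> Suc (degree p)"
    by (rule degree_pCons_le)
  then have "op_mult (pCons a p) q =
      (\<Sum>i\<le>Suc (degree p). smult (coeff (pCons a p) i) ((theta_left ^^ i) q))"
    by (rule op_mult_bound)
  also have "\<dots> = smult a q + op_mult p (theta_left q)"
    by (subst sum.atMost_Suc_shift) (simp add: op_mult_def funpow_swap1)
  finally show ?thesis .
qed

lemma op_mult_theta_left: "op_mult (theta_left p) q = theta_left (op_mult p q)"
proof (induction p arbitrary: q)
  case (pCons a p)
  have "theta_left (pCons a p) = pCons (zderiv a) (pCons a 0 + theta_left p)"
    by (rule poly_eqI)
       (auto simp: theta_left_def coeff_map_poly coeff_pCons split: nat.splits)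
  then show ?case
    by (simp add: op_mult_pCons op_mult_add_left pCons.IH theta_left_add theta_left_smult)
qed simp

lemma op_mult_theta_left_pow: "op_mult ((theta_left ^^ i) p) q = (theta_left ^^ i) (op_mult p q)"
  by (induction i) (simp_all add: op_mult_theta_left)

lemma op_mult_assoc: "op_mult (op_mult p q) r = op_mult p (op_mult q r)"
proof (induction p arbitrary: q)
  case (pCons a p)
  then show ?case
    by (simp add: op_mult_pCons op_mult_add_left op_mult_smult op_mult_theta_left)
qed simp

lemma op_mult_1_left: "op_mult 1 q = q"
  by (simp add: op_mult_def)

lemma op_mult_1_right: "op_mult p 1 = p"
  by (simp add: op_mult_def theta_left_pow_1 smult_monom poly_as_sum_of_monoms)

instantiation diffop :: ring_1
begin

lift_definition zero_diffop :: diffop is "0" .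
lift_definition one_diffop :: diffop is "1" .
lift_definition plus_diffop :: "diffop \<Rightarrow> diffop \<Rightarrow> diffop" is "(+)" .
lift_definition minus_diffop :: "diffop \<Rightarrow> diffop \<Rightarrow> diffop" is "(-)" .
lift_definition uminus_diffop :: "diffop \<Rightarrow> diffop" is "uminus" .
lift_definition times_diffop :: "diffop \<Rightarrow> diffop \<Rightarrow> diffop" is op_mult .

instance
  by standard
     (transfer; simp add: op_mult_assoc op_mult_1_left op_mult_1_right
        op_mult_add_left op_mult_add_right add.assoc add.commute)+

end

definition mult_op :: "complex fls \<Rightarrow> diffop" where
  "mult_op f = Diffop [:f:]"

abbreviation const_op :: "complex \<Rightarrow> diffop" where
  "const_op c \<equiv> mult_op (fls_const c)"

definition theta :: diffop where
  "theta = Diffop [:0, 1:]"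

definition op_coeff :: "diffop \<Rightarrow> nat \<Rightarrow> complex fls" where
  "op_coeff A i = coeff (op_poly A) i"

definition op_act :: "diffop \<Rightarrow> complex fls \<Rightarrow> complex fls" where
  "op_act A f = (\<Sum>i\<le>degree (op_poly A). op_coeff A i * (zderiv ^^ i) f)"

lemma theta_mult_op: "theta * mult_op f = mult_op f * theta + mult_op (zderiv f)"
  by (simp add: mult_op_def theta_def times_diffop_def plus_diffop_def Diffop_inverse
      op_mult_pCons theta_left_def map_poly_pCons)

text \<open>The formal product is composition of the operators.\<close>

lemma op_act_mult: "op_act (A * B) f = op_act A (op_act B f)"
proof -
  define act where "act p f = (\<Sum>i\<le>degree p. coeff p i * (zderiv ^^ i) f)"
    for p :: "complex fls poly" and f :: "complex fls"
  have bound: "act p f = (\<Sum>i\<le>n. coeff p i * (zderiv ^^ i) f)" if "degree p \<le> n" for p f n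
    unfolding act_def
    by (rule sum.mono_neutral_left) (use that in \<open>auto simp: coeff_eq_0\<close>)
  have act_0 [simp]: "act 0 f = 0" for f
    by (simp add: act_def)
  have act_add: "act (p + q) f = act p f + act q f" for p q f
  proof -
    define n where "n = max (degree p) (degree q)"
    have "degree (p + q) \<le> n" "degree p \<le> n" "degree q \<le> n"
      by (auto simp: n_def degree_add_le)
    then show ?thesis
      by (simp add: bound sum.distrib distrib_right)
  qed
  have act_smult: "act (smult a p) f = a * act p f" for a p f
    using degree_smult_le [of a p]
    by (simp add: bound [of _ "degree p"] sum_distrib_left mult.assoc)
  have act_pCons: "act (pCons a p) f = a * f + act p (zderiv f)" for a p f
  proof -
    have "act (pCons a p) f = (\<Sum>i\<le>Suc (degree p). coeff (pCons a p) i * (zderiv ^^ i) f)"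
      by (rule bound) (rule degree_pCons_le)
    also have "\<dots> = a * f + act p (zderiv f)"
      by (subst sum.atMost_Suc_shift) (simp add: act_def funpow_swap1)
    finally show ?thesis .
  qed
  have act_theta: "act (theta_left p) f = zderiv (act p f)" for p f
  proof (induction p arbitrary: f)
    case (pCons a p)
    have "theta_left (pCons a p) = pCons (zderiv a) (pCons a 0 + theta_left p)"
      by (rule poly_eqI)
         (auto simp: theta_left_def coeff_map_poly coeff_pCons split: nat.splits)
    then show ?case
      by (simp add: act_pCons act_add pCons.IH zderiv_add zderiv_mult)
  qed simp
  have "act (op_mult p q) f = act p (act q f)" for p q
  proof (induction p arbitrary: q)
    case (pCons a p)
    then show ?case
      by (simp add: op_mult_pCons act_add act_smult act_pCons act_theta)
  qed simp
  moreover have "op_act A f = act (op_poly A) f" for A f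
    by (simp add: op_act_def op_coeff_def act_def)
  ultimately show ?thesis
    by (simp add: times_diffop.rep_eq)
qed

definition diffops_loc :: "diffop set" where
  "diffops_loc = {A. \<forall>i. op_coeff A i \<in> laurent_polys_loc}"


section \<open>Matrices\<close>

definition mat2 :: "'a::zero \<Rightarrow> 'a \<Rightarrow> 'a \<Rightarrow> 'a \<Rightarrow> 'a ^ 2 ^ 2" where
  "mat2 a b c d = vector [vector [a, b], vector [c, d]]"

definition matrix_act :: "diffop ^ 2 ^ 2 \<Rightarrow> complex fls ^ 2 ^ 2 \<Rightarrow> complex fls ^ 2 ^ 2" where
  "matrix_act S F = (\<chi> i j. \<Sum>l\<in>UNIV. op_act (S $ i $ l) (F $ l $ j))"

definition matrix_polys_in_x :: "(complex fls ^ 2 ^ 2) set" where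
  "matrix_polys_in_x = {F. \<forall>i j. F $ i $ j \<in> polys_in_x}"


section \<open>Shift operators\<close>

definition G_plus :: "complex \<times> complex \<Rightarrow> diffop" where
  "G_plus k = mult_op (1 / (Z - inverse Z)) * theta"

definition G_minus :: "complex \<times> complex \<Rightarrow> diffop" where
  "G_minus k = mult_op (Z - inverse Z) * theta
     + const_op (fst k + 2 * snd k - 1) * mult_op (Z + inverse Z) + const_op (2 * fst k)"

definition E_plus :: "complex \<times> complex \<Rightarrow> diffop" where
  "E_plus k = mult_op ((1 + inverse Z) / (1 - inverse Z)) * theta + const_op (snd k - 1/2)"

definition E_minus :: "complex \<times> complex \<Rightarrow> diffop" where
  "E_minus k = mult_op ((1 - inverse Z) / (1 + inverse Z)) * theta + const_op (fst k + snd k - 1/2)"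

definition k_plus :: "complex \<times> complex \<Rightarrow> complex \<times> complex" where
  "k_plus k = k + (1, 0)"

definition k_minus :: "complex \<times> complex \<Rightarrow> complex \<times> complex" where
  "k_minus k = k + (-1, 1)"

definition D_op :: "complex \<times> complex \<Rightarrow> diffop ^ 2 ^ 2" where
  "D_op k = mat2 (const_op (1/2 * (1 - fst k))) (- E_plus (k_minus k))
                 (- E_minus (k_plus k)) (const_op (1/2 * (1 + fst k)))"

definition is_shift_operator ::
    "complex \<times> complex \<Rightarrow> complex \<times> complex \<Rightarrow> diffop ^ 2 ^ 2 \<Rightarrow> bool" where
  "is_shift_operator k l S \<longleftrightarrow>
     (\<forall>i j. S $ i $ j \<in> diffops_loc) \<and>
     S ** D_op k = D_op (k + l) ** S \<and>
     (\<forall>F \<in> matrix_polys_in_x. matrix_act S F \<in> matrix_polys_in_x)"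

definition G_hat_plus :: "complex \<times> complex \<Rightarrow> diffop ^ 2 ^ 2" where
  "G_hat_plus k = mat2 (G_plus (k_plus k)) 0 0 (G_plus (k_minus k))"

definition G_hat_minus :: "complex \<times> complex \<Rightarrow> diffop ^ 2 ^ 2" where
  "G_hat_minus k = mat2 (G_minus (k_plus k)) 0 0 (G_minus (k_minus k))"

definition E_hat_plus :: "complex \<times> complex \<Rightarrow> complex \<Rightarrow> diffop ^ 2 ^ 2" where
  "E_hat_plus k c = mat2 (E_plus (k_plus k)) 0 (const_op c) (E_plus (k_minus k))"

definition E_hat_minus :: "complex \<times> complex \<Rightarrow> complex \<Rightarrow> diffop ^ 2 ^ 2" where
  "E_hat_minus k c = mat2 (E_minus (k_plus k)) (const_op c) 0 (E_minus (k_minus k))"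

end

theory Submission imports Defs
begin

text \<open>
  With \<open>z = e^u\<close> one has \<open>x = cosh u\<close> and \<open>\<Delta> = 2 sinh u\<close>, and the coefficients of \<open>E\<^sub>+\<close> and
  \<open>E\<^sub>-\<close> are \<open>coth (u/2) = 2 (x + 1) / \<Delta>\<close> and \<open>tanh (u/2) = 2 (x - 1) / \<Delta>\<close>.  So every operator in
  sight is of the form \<open>a \<theta> + b\<close>, where \<open>\<theta> = z\<partial>\<^sub>z\<close> and \<open>a, b\<close> are polynomials in \<open>x\<close>, \<open>\<Delta>\<close>
  and \<open>1/\<Delta>\<close>.  These are subject to \<open>\<Delta>\<^sup>2 = 4 (x\<^sup>2 - 1)\<close>, and \<open>\<theta> x = \<Delta>/2\<close>, \<open>\<theta> \<Delta> = 2 x\<close>.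

  \<^bold>\<open>Invariant polynomials are preserved.\<close>  Since \<open>\<theta> (p(x)) = \<Delta>/2 p'(x)\<close>, the operator
  \<open>a \<theta> + b\<close> preserves the polynomials in \<open>x\<close> as soon as \<open>a \<Delta>\<close> and \<open>b\<close> are such polynomials
  (\<open>admissible_first_order\<close>).  For the four kinds of operators \<open>a \<Delta>\<close> is \<open>1\<close>, \<open>4 (x\<^sup>2 - 1)\<close>,
  \<open>2 (x + 1)\<close> and \<open>2 (x - 1)\<close>.

  \<^bold>\<open>Intertwining.\<close>  Comparing the entries of \<open>S D\<^sub>k = D\<^sub>k\<^sub>+\<^sub>l S\<close> leaves scalar identities.  The
  operators \<open>G\<^sub>\<plusminus>\<close> pass through \<open>E\<^sub>+\<close> and \<open>E\<^sub>-\<close> and raise or lower their constant terms by one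
  (\<open>G_plus_E_plus\<close>, \<open>G_plus_E_minus\<close>, \<open>G_minus_E_plus\<close>, \<open>G_minus_E_minus\<close>).  Exchanging
  \<open>E\<^sub>+\<close> with \<open>E\<^sub>-\<close> instead produces a constant, \<open>1 + k\<^sub>1\<close> in one order and \<open>1 - k\<^sub>1\<close> in the other
  (\<open>E_plus_E_minus\<close>, \<open>E_minus_E_plus\<close>).  This is what an off-diagonal entry \<open>\<gamma>\<close> has to
  compensate: the value \<open>-1\<close> does so, and it is forced by the upper left entry, which
  reads \<open>(\<gamma> + 1) E = 0\<close> with \<open>E \<noteq> 0\<close>.
\<close>

section \<open>Derivatives in the field generated by \<open>x\<close> and \<open>\<Delta>\<close>\<close>

lemma Delta_nth: "fls_nth Delta n = (if n = 1 then 1 else if n = -1 then -1 else 0)"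
  by (simp add: Delta_def fls_inverse_X)

lemma Delta_nonzero [simp]: "Delta \<noteq> 0"
proof
  assume "Delta = 0"
  then show False
    using Delta_nth [of 1] by simp
qed

lemma x_elem_double: "Z + inverse Z = 2 * x_elem"
  by (simp add: x_elem_def)

lemma Delta_square: "Delta * Delta = 4 * (x_elem * x_elem - 1)"
proof -
  have "Z * inverse Z = 1"
    by simp
  then show ?thesis
    unfolding Delta_def x_elem_def by (simp add: field_simps)
qed

lemma zderiv_const [simp]: "zderiv (fls_const c) = 0"
  by (simp add: zderiv_def)

lemma zderiv_numeral [simp]: "zderiv (numeral n) = 0"
  by (simp add: zderiv_def)

lemma zderiv_diff: "zderiv (f - g) = zderiv f - zderiv g"
  by (simp add: zderiv_def algebra_simps)

lemma zderiv_inverse: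
  assumes "f \<noteq> 0"
  shows "zderiv (inverse f) = - zderiv f * inverse f * inverse f"
proof -
  have "0 = zderiv (f * inverse f)"
    using assms by simp
  also have "\<dots> = f * zderiv (inverse f) + zderiv f * inverse f"
    by (rule zderiv_mult)
  finally have "f * zderiv (inverse f) = - zderiv f * inverse f"
    by (simp add: eq_neg_iff_add_eq_0)
  then show ?thesis
    using assms by (simp add: field_simps)
qed

lemma zderiv_Z: "zderiv Z = Z"
  by (simp add: zderiv_def)

lemma zderiv_inverse_Z: "zderiv (inverse Z) = - inverse Z"
  by (simp add: zderiv_inverse zderiv_Z)

lemma zderiv_Delta: "zderiv Delta = 2 * x_elem"
  by (simp add: Delta_def zderiv_diff zderiv_Z zderiv_inverse_Z x_elem_double)

lemma zderiv_x_elem: "zderiv x_elem = Delta / 2"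
proof -
  have "zderiv (Z + inverse Z) = Delta"
    by (simp add: Delta_def zderiv_add zderiv_Z zderiv_inverse_Z)
  then show ?thesis
    by (simp add: x_elem_double zderiv_mult mult.commute)
qed

definition Delta_inv :: "complex fls" where
  "Delta_inv = 1 / Delta"

text \<open>
  Under \<open>z = e^u\<close> the following two elements are \<open>coth (u/2)\<close> and \<open>tanh (u/2)\<close>.  Writing them as
  polynomials in \<open>x\<close> and \<open>1/\<Delta>\<close> turns all identities between coefficients into consequences
  of the two polynomial relations \<open>Delta_inv_Delta\<close> and \<open>Delta_square\<close>.
\<close>

definition coth_half :: "complex fls" where
  "coth_half = 2 * (x_elem + 1) * Delta_inv"

definition tanh_half :: "complex fls" where
  "tanh_half = 2 * (x_elem - 1) * Delta_inv"

lemma Delta_inv_Delta: "Delta_inv * Delta = 1"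
  by (simp add: Delta_inv_def)

lemma zderiv_Delta_inv: "zderiv Delta_inv = - 2 * x_elem * Delta_inv * Delta_inv"
  using zderiv_inverse [OF Delta_nonzero]
  by (simp add: Delta_inv_def zderiv_Delta field_simps)

lemma zderiv_coth_half: "zderiv coth_half = - 2 * coth_half * Delta_inv"
proof -
  have "zderiv coth_half = Delta * Delta_inv - 4 * (x_elem + 1) * x_elem * Delta_inv * Delta_inv"
    by (simp add: coth_half_def zderiv_mult zderiv_add zderiv_x_elem zderiv_Delta_inv algebra_simps)
  then show ?thesis
    unfolding coth_half_def using Delta_inv_Delta Delta_square by algebra
qed

lemma zderiv_tanh_half: "zderiv tanh_half = 2 * tanh_half * Delta_inv"
proof -
  have "zderiv tanh_half = Delta * Delta_inv - 4 * (x_elem - 1) * x_elem * Delta_inv * Delta_inv"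
    by (simp add: tanh_half_def zderiv_mult zderiv_diff zderiv_x_elem zderiv_Delta_inv algebra_simps)
  then show ?thesis
    unfolding tanh_half_def using Delta_inv_Delta Delta_square by algebra
qed

lemma coth_tanh_half: "coth_half * tanh_half = 1"
  unfolding coth_half_def tanh_half_def using Delta_inv_Delta Delta_square by algebra

lemma coth_half_eq: "(1 + inverse Z) / (1 - inverse Z) = coth_half"
proof -
  have "(1 - inverse Z) * (1 + inverse Z) * Z = Delta"
    by (simp add: Delta_def algebra_simps)
  then have nz: "1 - inverse Z \<noteq> 0"
    using Delta_nonzero by (metis mult_zero_left)
  have "Z * inverse Z = 1"
    by simp
  then have "(1 + inverse Z) * Delta = 2 * (x_elem + 1) * (1 - inverse Z)"
    using x_elem_double unfolding Delta_def by algebra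
  then show ?thesis
    using nz by (simp add: coth_half_def Delta_inv_def field_simps)
qed

lemma tanh_half_eq: "(1 - inverse Z) / (1 + inverse Z) = tanh_half"
proof -
  have "(1 - inverse Z) / (1 + inverse Z) = inverse coth_half"
    by (simp flip: coth_half_eq)
  also have "\<dots> = tanh_half"
    using coth_tanh_half by (simp add: inverse_unique)
  finally show ?thesis .
qed

section \<open>Operators of order at most two\<close>

text \<open>
  The operator \<open>a \<theta>\<^sup>2 + b \<theta> + c\<close>.  First-order operators are the case \<open>a = 0\<close>, so that
  products of two of them are compared coefficientwise.
\<close>

definition second_order :: "complex fls \<Rightarrow> complex fls \<Rightarrow> complex fls \<Rightarrow> diffop" where
  "second_order a b c = Diffop [:c, b, a:]"

lemma second_order_eq_iff:
  "second_order a b c = second_order a' b' c' \<longleftrightarrow> a = a' \<and> b = b' \<and> c = c'"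
  by (auto simp: second_order_def Diffop_inject)

lemma second_order_add:
  "second_order a b c + second_order a' b' c' = second_order (a + a') (b + b') (c + c')"
  by (simp add: second_order_def plus_diffop_def Diffop_inverse)

lemma second_order_uminus:
  "- second_order a b c = second_order (- a) (- b) (- c)"
  by (simp add: second_order_def uminus_diffop_def Diffop_inverse)

lemma second_order_0: "second_order 0 0 0 = 0"
  by (simp add: second_order_def zero_diffop_def)

lemma first_order_mult:
  "second_order 0 a b * second_order 0 c d
     = second_order (a * c) (a * (zderiv c + d) + b * c) (a * zderiv d + b * d)"
  by (simp add: second_order_def times_diffop_def Diffop_inverse op_mult_pCons theta_left_def
      map_poly_pCons algebra_simps)

lemma const_op_mult:
  "const_op r * second_order a b c
     = second_order (fls_const r * a) (fls_const r * b) (fls_const r * c)"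
  by (simp add: second_order_def mult_op_def times_diffop_def Diffop_inverse op_mult_pCons)

lemma mult_op_eq: "mult_op f = second_order 0 0 f"
  by (simp add: second_order_def mult_op_def)

lemma mult_op_theta: "mult_op f * theta = second_order 0 f 0"
  by (simp add: second_order_def mult_op_def theta_def times_diffop_def Diffop_inverse op_mult_pCons
      theta_left_def map_poly_pCons)

lemma op_act_first_order: "op_act (second_order 0 a b) f = a * zderiv f + b * f"
proof -
  have "op_act (second_order 0 a b) f = (\<Sum>i\<le>1. coeff [:b, a:] i * (zderiv ^^ i) f)"
    unfolding op_act_def op_coeff_def second_order_def Diffop_inverse [OF UNIV_I] pCons_0_0
    by (rule sum.mono_neutral_left) (auto simp: coeff_eq_0)
  then show ?thesis
    by (simp add: add.commute)
qed

section \<open>Operators preserving the invariant polynomials\<close>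

lemma laurent_polys_const: "fls_const c \<in> laurent_polys"
  and laurent_polys_Z: "Z \<in> laurent_polys"
  and laurent_polys_inverse_Z: "inverse Z \<in> laurent_polys"
  by (simp_all add: laurent_polys_def fls_inverse_X)

lemma laurent_polys_add: "f + g \<in> laurent_polys" if "f \<in> laurent_polys" "g \<in> laurent_polys"
proof -
  have "{n. fls_nth (f + g) n \<noteq> 0} \<subseteq> {n. fls_nth f n \<noteq> 0} \<union> {n. fls_nth g n \<noteq> 0}"
    by auto
  then show ?thesis
    using that finite_subset unfolding laurent_polys_def by blast
qed

lemma laurent_polys_const_mult: "fls_const c * f \<in> laurent_polys" if "f \<in> laurent_polys"
proof -
  have "{n. fls_nth (fls_const c * f) n \<noteq> 0} \<subseteq> {n. fls_nth f n \<noteq> 0}"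
    by auto
  then show ?thesis
    using that finite_subset unfolding laurent_polys_def by blast
qed

lemma laurent_polys_x_elem: "fls_const c * x_elem \<in> laurent_polys"
proof -
  have "x_elem = fls_const (1/2) * (Z + inverse Z)"
    by (simp add: x_elem_def fls_const_divide_const [symmetric])
  then show ?thesis
    using laurent_polys_const_mult laurent_polys_add laurent_polys_Z laurent_polys_inverse_Z
    by metis
qed

lemma laurent_polys_Delta: "Delta \<in> laurent_polys"
proof -
  have "Delta = Z + fls_const (-1) * inverse Z"
    by (simp add: Delta_def)
  then show ?thesis
    by (metis laurent_polys_const_mult laurent_polys_add laurent_polys_Z
        laurent_polys_inverse_Z)
qed

lemma laurent_polys_imp_loc: "f \<in> laurent_polys \<Longrightarrow> f \<in> laurent_polys_loc"
  unfolding laurent_polys_loc_def by (rule CollectI, rule exI [of _ f], rule exI [of _ 0]) simp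

lemma laurent_polys_mult_Delta_inv: "f \<in> laurent_polys \<Longrightarrow> f * Delta_inv \<in> laurent_polys_loc"
  unfolding laurent_polys_loc_def Delta_inv_def
  by (rule CollectI, rule exI [of _ f], rule exI [of _ 1]) simp

definition eval_x :: "complex poly \<Rightarrow> complex fls" where
  "eval_x p = poly (map_poly fls_const p) x_elem"

lemma polys_in_x_eq_range_eval_x: "polys_in_x = range eval_x"
  by (simp add: polys_in_x_def eval_x_def)

lemma eval_x_0 [simp]: "eval_x 0 = 0"
  by (simp add: eval_x_def)

lemma eval_x_pCons: "eval_x (pCons c p) = fls_const c + x_elem * eval_x p"
  by (simp add: eval_x_def map_poly_pCons)

lemma eval_x_add: "eval_x (p + q) = eval_x p + eval_x q"
proof -
  have "map_poly fls_const (p + q) = map_poly fls_const p + map_poly fls_const q"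
    by (rule poly_eqI) (simp add: coeff_map_poly fls_plus_const)
  then show ?thesis
    by (simp add: eval_x_def)
qed

lemma eval_x_smult: "eval_x (smult c p) = fls_const c * eval_x p"
proof -
  have "map_poly fls_const (smult c p) = smult (fls_const c) (map_poly fls_const p)"
    by (rule poly_eqI) (simp add: coeff_map_poly)
  then show ?thesis
    by (simp add: eval_x_def)
qed

lemma eval_x_mult: "eval_x (p * q) = eval_x p * eval_x q"
  by (induction p) (simp_all add: eval_x_add eval_x_smult eval_x_pCons algebra_simps)

lemma zderiv_eval_x: "zderiv (eval_x p) = Delta / 2 * eval_x (pderiv p)"
proof (induction p)
  case (pCons c p)
  then show ?case
    by (simp add: eval_x_pCons pderiv_pCons zderiv_add zderiv_mult zderiv_x_elem eval_x_add
        algebra_simps)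
qed (simp add: zderiv_def)

lemma polys_in_x_add: "f \<in> polys_in_x \<Longrightarrow> g \<in> polys_in_x \<Longrightarrow> f + g \<in> polys_in_x"
  unfolding polys_in_x_eq_range_eval_x by (auto simp flip: eval_x_add)

lemma polys_in_x_mult: "f \<in> polys_in_x \<Longrightarrow> g \<in> polys_in_x \<Longrightarrow> f * g \<in> polys_in_x"
  unfolding polys_in_x_eq_range_eval_x by (auto simp flip: eval_x_mult)

lemma polys_in_x_linear: "fls_const a * x_elem + fls_const b \<in> polys_in_x"
proof -
  have "fls_const a * x_elem + fls_const b = eval_x [:b, a:]"
    by (simp add: eval_x_pCons algebra_simps)
  then show ?thesis
    by (simp add: polys_in_x_eq_range_eval_x)
qed

text \<open>
  The conditions on an operator matrix other than the intertwining relation, read off for a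
  single entry: a matrix of such entries satisfies them because polynomials in \<open>x\<close> are
  closed under addition.
\<close>

definition admissible :: "diffop \<Rightarrow> bool" where
  "admissible A \<longleftrightarrow> A \<in> diffops_loc \<and> (\<forall>f\<in>polys_in_x. op_act A f \<in> polys_in_x)"

lemma laurent_polys_loc_0: "0 \<in> laurent_polys_loc"
  using laurent_polys_imp_loc [OF laurent_polys_const [of 0]] by simp

text \<open>
  The derivation \<open>\<theta>\<close> takes polynomials in \<open>x\<close> to \<open>\<Delta>\<close> times such polynomials, so the pole that
  \<open>a\<close> may have along \<open>\<Delta> = 0\<close> is cancelled.
\<close>

lemma admissible_first_order:
  assumes "a \<in> laurent_polys_loc" "b \<in> laurent_polys_loc"
    and "a * Delta \<in> polys_in_x" "b \<in> polys_in_x"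
  shows "admissible (second_order 0 a b)"
  unfolding admissible_def
proof (intro conjI ballI)
  have "op_coeff (second_order 0 a b) i = (if i = 0 then b else if i = 1 then a else 0)" for i
    by (auto simp: op_coeff_def second_order_def Diffop_inverse coeff_pCons split: nat.splits)
  then show "second_order 0 a b \<in> diffops_loc"
    using assms laurent_polys_loc_0 by (simp add: diffops_loc_def)
next
  fix f assume f: "f \<in> polys_in_x"
  then obtain p where p: "f = eval_x p"
    by (auto simp: polys_in_x_eq_range_eval_x)
  have "a * zderiv f = (a * Delta) * eval_x (smult (1/2) (pderiv p))"
    by (simp add: p zderiv_eval_x eval_x_smult fls_const_divide_const [symmetric])
  moreover have "eval_x (smult (1/2) (pderiv p)) \<in> polys_in_x"
    by (simp add: polys_in_x_eq_range_eval_x)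
  ultimately show "op_act (second_order 0 a b) f \<in> polys_in_x"
    using assms f unfolding op_act_first_order by (metis polys_in_x_add polys_in_x_mult)
qed

section \<open>The scalar operators in normal form\<close>

lemma fls_const_fraction:
  "fls_const (1 / numeral n :: complex) = 1 / numeral n"
  "fls_const (numeral m / numeral n :: complex) = numeral m / numeral n"
  by (simp_all add: fls_const_divide_const [symmetric])

lemmas fls_const_hom =
  fls_plus_const [symmetric] fls_minus_const [symmetric] fls_const_mult_const [symmetric]
  fls_const_fraction

lemma G_plus_eq: "G_plus k = second_order 0 Delta_inv 0"
  by (simp add: G_plus_def mult_op_theta Delta_inv_def Delta_def)

lemma G_minus_eq:
  "G_minus k = second_order 0 Delta
     (fls_const (2 * (fst k + 2 * snd k - 1)) * x_elem + fls_const (2 * fst k))"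
proof -
  have "const_op r * mult_op (Z + inverse Z) = second_order 0 0 (fls_const (2 * r) * x_elem)" for r
    by (simp add: mult_op_eq first_order_mult x_elem_double fls_const_hom ac_simps
        del: fls_const_mult_const)
  then show ?thesis
    unfolding G_minus_def mult_op_theta by (simp add: second_order_add mult_op_eq flip: Delta_def)
qed

lemma E_plus_eq: "E_plus k = second_order 0 coth_half (fls_const (snd k - 1/2))"
  unfolding E_plus_def coth_half_eq mult_op_theta by (simp add: second_order_add mult_op_eq)

lemma E_minus_eq: "E_minus k = second_order 0 tanh_half (fls_const (fst k + snd k - 1/2))"
  unfolding E_minus_def tanh_half_eq mult_op_theta by (simp add: second_order_add mult_op_eq)

lemma polys_in_x_const: "fls_const c \<in> polys_in_x"
  using polys_in_x_linear [of 0 c] by simp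

lemma admissible_0: "admissible 0"
  and admissible_const: "admissible (const_op c)"
  using admissible_first_order [of 0 "fls_const c" for c] polys_in_x_const [of 0]
    polys_in_x_const [of c] laurent_polys_loc_0 laurent_polys_imp_loc [OF laurent_polys_const]
    admissible_first_order [of 0 0]
  by (simp_all add: mult_op_eq second_order_0)

lemma admissible_G_plus: "admissible (G_plus k)"
  unfolding G_plus_eq
proof (rule admissible_first_order)
  show "Delta_inv \<in> laurent_polys_loc"
    using laurent_polys_mult_Delta_inv [OF laurent_polys_const [of 1]] by simp
  show "Delta_inv * Delta \<in> polys_in_x"
    using polys_in_x_const [of 1] by (simp add: Delta_inv_Delta)
qed (use laurent_polys_loc_0 polys_in_x_const [of 0] in simp_all)

lemma admissible_G_minus: "admissible (G_minus k)"
  unfolding G_minus_eq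
proof (rule admissible_first_order)
  have "Delta * Delta = 4 * (x_elem + 1) * (x_elem - 1)"
    by (simp add: Delta_square algebra_simps)
  also have "\<dots> = (fls_const 4 * x_elem + fls_const 4) * (fls_const 1 * x_elem + fls_const (-1))"
    by (simp add: algebra_simps)
  finally show "Delta * Delta \<in> polys_in_x"
    by (simp only: polys_in_x_mult polys_in_x_linear)
qed (intro laurent_polys_imp_loc laurent_polys_Delta laurent_polys_add laurent_polys_x_elem
    laurent_polys_const polys_in_x_linear)+

lemma admissible_E_plus: "admissible (E_plus k)"
  unfolding E_plus_eq
proof (rule admissible_first_order)
  have eq: "2 * (x_elem + 1) = fls_const 2 * x_elem + fls_const 2"
    by simp
  show "coth_half \<in> laurent_polys_loc"
    unfolding coth_half_def eq
    by (intro laurent_polys_mult_Delta_inv laurent_polys_add laurent_polys_x_elem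
        laurent_polys_const)
  have "coth_half * Delta = fls_const 2 * x_elem + fls_const 2"
    unfolding coth_half_def by (simp add: mult.assoc Delta_inv_Delta)
  then show "coth_half * Delta \<in> polys_in_x"
    by (simp only: polys_in_x_linear)
qed (intro laurent_polys_imp_loc laurent_polys_const polys_in_x_const)+

lemma admissible_E_minus: "admissible (E_minus k)"
  unfolding E_minus_eq
proof (rule admissible_first_order)
  have eq: "2 * (x_elem - 1) = fls_const 2 * x_elem + fls_const (-2)"
    by simp
  show "tanh_half \<in> laurent_polys_loc"
    unfolding tanh_half_def eq
    by (intro laurent_polys_mult_Delta_inv laurent_polys_add laurent_polys_x_elem
        laurent_polys_const)
  have "tanh_half * Delta = fls_const 2 * x_elem + fls_const (-2)"
    unfolding tanh_half_def by (simp add: mult.assoc Delta_inv_Delta)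
  then show "tanh_half * Delta \<in> polys_in_x"
    by (simp only: polys_in_x_linear)
qed (intro laurent_polys_imp_loc laurent_polys_const polys_in_x_const)+

section \<open>Scalar intertwining relations\<close>

lemma const_op_hom:
  "const_op (r + s) = const_op r + const_op s"
  "const_op (r - s) = const_op r - const_op s"
  "const_op (- r) = - const_op r"
  "const_op (r * s) = const_op r * const_op s"
proof -
  show "const_op (- r) = - const_op r"
    by (simp add: mult_op_eq second_order_uminus)
  show add: "const_op (r + s) = const_op r + const_op s" for r s
    by (simp add: mult_op_eq second_order_add fls_plus_const)
  show "const_op (r - s) = const_op r - const_op s"
    using add [of "r - s" s] by simp
  show "const_op (r * s) = const_op r * const_op s"
    by (simp add: mult_op_eq first_order_mult)
qed

lemma first_order_commute_const:
  "second_order 0 a b * const_op r = const_op r * second_order 0 a b"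
  by (simp add: mult_op_eq first_order_mult algebra_simps)

lemma commute_G_plus: "G_plus k * const_op r = const_op r * G_plus k"
  and commute_G_minus: "G_minus k * const_op r = const_op r * G_minus k"
  and commute_E_plus: "E_plus k * const_op r = const_op r * E_plus k"
  and commute_E_minus: "E_minus k * const_op r = const_op r * E_minus k"
  by (simp_all only: G_plus_eq G_minus_eq E_plus_eq E_minus_eq first_order_commute_const)

lemma k_plus_add: "k_plus (k + l) = k_plus k + l"
  and k_minus_add: "k_minus (k + l) = k_minus k + l"
  by (simp_all add: k_plus_def k_minus_def algebra_simps)

text \<open>
  The two neighbours \<open>k\<^sub>+\<close> and \<open>k\<^sub>-\<close> of \<open>k\<close> differ by exactly the shift of the operators
  \<open>E\<^sub>\<plusminus>\<close>; hence, up to sign, an off-diagonal entry of the shifted operator coincides with a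
  diagonal entry of the shift operator.
\<close>

lemma k_minus_shift: "k_minus k + (2, -1) = k_plus k"
  and k_plus_shift: "k_plus k + (-2, 1) = k_minus k"
  by (simp_all add: k_plus_def k_minus_def add.assoc)

text \<open>
  Expanding a product with these rules leaves identities between coefficients.  The scalars
  \<open>fls_const _\<close> must still be intact at that point, for then their derivatives vanish; only
  afterwards are they split into sums and products, which makes the identities polynomial.
\<close>

lemmas second_order_calculus =
  G_plus_eq G_minus_eq E_plus_eq E_minus_eq k_plus_def k_minus_def mult_op_eq first_order_mult
  second_order_add second_order_eq_iff
  zderiv_add zderiv_mult zderiv_x_elem zderiv_Delta zderiv_Delta_inv
  zderiv_coth_half zderiv_tanh_half

text \<open>
  The parameters of \<open>G\<^sub>+\<close> on the two sides are independent, because \<open>G\<^sub>+\<close> is constant in \<open>k\<close>.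
  The relation amounts to \<open>\<theta> (\<Delta> coth (u/2)) = \<theta> (2 (x + 1)) = \<Delta>\<close>.
\<close>

lemma G_plus_E_plus: "G_plus j * E_plus k = E_plus (k + (0, 1)) * G_plus j'"
  by (simp add: second_order_calculus,
      simp add: fls_const_hom del: fls_const_mult_const,
      ((intro conjI)?; use Delta_inv_Delta Delta_square coth_half_def tanh_half_def in algebra))

lemma G_plus_E_minus: "G_plus j * E_minus k = E_minus (k + (0, 1)) * G_plus j'"
  by (simp add: second_order_calculus,
      simp add: fls_const_hom del: fls_const_mult_const,
      ((intro conjI)?; use Delta_inv_Delta Delta_square coth_half_def tanh_half_def in algebra))

text \<open>
  Here \<open>G\<^sub>-(k\<^sub>+)\<close> and \<open>G\<^sub>-(k\<^sub>-)\<close> share the coefficient \<open>k\<^sub>1 + 2 k\<^sub>2\<close> of \<open>z + 1/z\<close>, and their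
  constant terms \<open>2 k\<^sub>1 \<plusminus> 2\<close> differ by \<open>4\<close>; this difference is what makes the coefficients of
  \<open>\<theta>\<close> agree.
\<close>

lemma G_minus_E_plus:
  "G_minus (k_plus k) * E_plus (k_minus k) = E_plus (k_minus k + (0, -1)) * G_minus (k_minus k)"
  by (simp add: second_order_calculus,
      simp add: fls_const_hom del: fls_const_mult_const,
      ((intro conjI)?; use Delta_inv_Delta Delta_square coth_half_def tanh_half_def in algebra))

lemma G_minus_E_minus:
  "G_minus (k_minus k) * E_minus (k_plus k) = E_minus (k_plus k + (0, -1)) * G_minus (k_plus k)"
  by (simp add: second_order_calculus,
      simp add: fls_const_hom del: fls_const_mult_const,
      ((intro conjI)?; use Delta_inv_Delta Delta_square coth_half_def tanh_half_def in algebra))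

text \<open>
  Write the product on the left as \<open>(C \<theta> + a) (T \<theta> + b)\<close> with \<open>C T = 1\<close>.  Exchanging the factors while
  lowering \<open>a\<close> and raising \<open>b\<close> by one changes the coefficient of \<open>\<theta>\<close> by
  \<open>C \<theta>(T) - T \<theta>(C) + T - C = 0\<close>, and the constant term by \<open>a b - (a - 1) (b + 1) = b - a + 1\<close>,
  which is \<open>1 + k\<^sub>1\<close>.
\<close>

lemma E_plus_E_minus:
  "E_plus (k_minus k) * E_minus (k_plus k)
     = E_minus (k_plus k + (2, -1)) * E_plus (k_plus k) + const_op (1 + fst k)"
proof -
  have difference: "coth_half - tanh_half = 4 * Delta_inv"
    by (simp add: coth_half_def tanh_half_def algebra_simps)
  show ?thesis
    by (simp add: second_order_calculus,
        simp add: fls_const_hom del: fls_const_mult_const,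
        intro conjI,
        use coth_tanh_half difference in algebra,
        simp add: field_simps)
qed

text \<open>
  This is the previous relation at the parameter \<open>k + (-2, 1)\<close>, whose neighbours are
  \<open>k\<^sub>- + (-2, 1)\<close> and \<open>k\<^sub>-\<close>.
\<close>

lemma E_minus_E_plus:
  "E_minus (k_plus k) * E_plus (k_minus k)
     = E_plus (k_minus k + (-2, 1)) * E_minus (k_minus k) + const_op (1 - fst k)"
proof -
  define k' where "k' = k + (-2, 1)"
  have "k_minus k' = k_minus k + (-2, 1)" "k_plus k' = k_minus k" "fst k' = fst k - 2"
    and "k_minus k + (2, -1) = k_plus k"
    by (simp_all add: k'_def k_minus_add k_plus_add k_plus_shift k_minus_shift)
  then have "E_plus (k_minus k + (-2, 1)) * E_minus (k_minus k)
      = E_minus (k_plus k) * E_plus (k_minus k) + const_op (1 + (fst k - 2))"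
    using E_plus_E_minus [of k'] by simp
  moreover have "const_op (1 - fst k) = - const_op (1 + (fst k - 2))"
    by (simp flip: const_op_hom)
  ultimately show ?thesis
    by simp
qed

section \<open>The matrix shift operators\<close>

lemma mat2_nth [simp]:
  "mat2 a b c d $ 1 $ 1 = a" "mat2 a b c d $ 1 $ 2 = b"
  "mat2 a b c d $ 2 $ 1 = c" "mat2 a b c d $ 2 $ 2 = d"
  by (simp_all add: mat2_def)

lemma mat2_eq_iff:
  "mat2 a b c d = mat2 a' b' c' d' \<longleftrightarrow> a = a' \<and> b = b' \<and> c = c' \<and> d = d'"
  by (metis mat2_nth)

lemma mat2_mult:
  fixes a b c d a' b' c' d' :: "'a::ring_1"
  shows "mat2 a b c d ** mat2 a' b' c' d'
     = mat2 (a * a' + b * c') (a * b' + b * d') (c * a' + d * c') (c * b' + d * d')"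
  by (simp add: vec_eq_iff forall_2 matrix_matrix_mult_def sum_2)

lemma is_shift_operator_mat2_iff:
  assumes "admissible a" "admissible b" "admissible c" "admissible d"
  shows "is_shift_operator k l (mat2 a b c d)
     \<longleftrightarrow> mat2 a b c d ** D_op k = D_op (k + l) ** mat2 a b c d"
  using assms
  by (auto simp: is_shift_operator_def admissible_def forall_2 matrix_act_def sum_2
      matrix_polys_in_x_def intro!: polys_in_x_add)

lemma const_op_E_plus_cancel: "const_op r * E_plus k = const_op s * E_plus k \<longleftrightarrow> r = s"
  and const_op_E_minus_cancel: "const_op r * E_minus k = const_op s * E_minus k \<longleftrightarrow> r = s"
proof -
  have "coth_half \<noteq> 0" "tanh_half \<noteq> 0"
    using coth_tanh_half by auto
  moreover have "fls_const r = fls_const s \<longleftrightarrow> r = s"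
    by (metis fls_const_nth)
  ultimately show "const_op r * E_plus k = const_op s * E_plus k \<longleftrightarrow> r = s"
    and "const_op r * E_minus k = const_op s * E_minus k \<longleftrightarrow> r = s"
    by (auto simp: E_plus_eq E_minus_eq const_op_mult second_order_eq_iff)
qed

lemma G_hat_plus_shift: "is_shift_operator k (0, 1) (G_hat_plus k)"
  unfolding G_hat_plus_def
  by (subst is_shift_operator_mat2_iff)
     (simp_all add: admissible_0 admissible_G_plus D_op_def mat2_mult mat2_eq_iff
       k_plus_add k_minus_add commute_G_plus G_plus_E_plus [of _ _ "k_minus k"]
       G_plus_E_minus [of _ _ "k_plus k"])

lemma G_hat_minus_shift: "is_shift_operator k (0, -1) (G_hat_minus k)"
  unfolding G_hat_minus_def
  by (subst is_shift_operator_mat2_iff)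
     (simp_all add: admissible_0 admissible_G_minus D_op_def mat2_mult mat2_eq_iff
       k_plus_add k_minus_add commute_G_minus G_minus_E_plus G_minus_E_minus)

text \<open>
  The upper right entries of both sides are the same product \<open>- E\<^sub>+(k\<^sub>+) E\<^sub>+(k\<^sub>-)\<close>, so three
  equations remain.  The upper left one is equivalent to \<open>c = -1\<close>; the other two then follow,
  the lower left one from \<open>E_plus_E_minus\<close>.
\<close>

lemma E_hat_plus_shift_iff: "is_shift_operator k (2, -1) (E_hat_plus k c) \<longleftrightarrow> c = -1"
  (is "?shift \<longleftrightarrow> _")
proof -
  have *: "?shift \<longleftrightarrow>
      E_plus (k_plus k) * const_op (1/2 * (1 - fst k))
        = const_op (1/2 * (1 - (fst k + 2))) * E_plus (k_plus k) - E_plus (k_plus k) * const_op c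
      \<and> const_op c * const_op (1/2 * (1 - fst k)) - E_plus (k_minus k) * E_minus (k_plus k)
        = - (E_minus (k_plus k + (2, -1)) * E_plus (k_plus k))
          + const_op (1/2 * (1 + (fst k + 2))) * const_op c
      \<and> - (const_op c * E_plus (k_minus k)) + E_plus (k_minus k) * const_op (1/2 * (1 + fst k))
        = const_op (1/2 * (1 + (fst k + 2))) * E_plus (k_minus k)"
    (is "_ \<longleftrightarrow> ?e11 \<and> ?e21 \<and> ?e22")
    unfolding E_hat_plus_def
    by (subst is_shift_operator_mat2_iff)
       (simp_all add: admissible_0 admissible_const admissible_E_plus D_op_def mat2_mult
         mat2_eq_iff k_plus_add k_minus_add k_minus_shift)
  have e11: "?e11 \<longleftrightarrow> c = -1"
  proof -
    have "?e11 \<longleftrightarrow> const_op (1/2 * (1 - fst k)) * E_plus (k_plus k)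
        = const_op (1/2 * (1 - (fst k + 2)) - c) * E_plus (k_plus k)"
      by (simp add: commute_E_plus const_op_hom(2) [of _ c] left_diff_distrib)
    also have "\<dots> \<longleftrightarrow> 1/2 * (1 - fst k) = 1/2 * (1 - (fst k + 2)) - c"
      by (rule const_op_E_plus_cancel)
    also have "\<dots> \<longleftrightarrow> c = -1"
    proof -
      have "1/2 * (1 - fst k) - (1/2 * (1 - (fst k + 2)) - c) = c - (-1)"
        by (simp add: field_simps)
      then show ?thesis
        by (metis eq_iff_diff_eq_0)
    qed
    finally show ?thesis .
  qed
  moreover have "?e21" "?e22" if "c = -1"
  proof -
    have "const_op (-1) * const_op (1/2 * (1 - fst k)) - const_op (1 + fst k)
        = const_op (1/2 * (1 + (fst k + 2))) * const_op (-1)"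
      unfolding const_op_hom(2,4) [symmetric] by (simp add: field_simps)
    then show "?e21"
      by (simp add: that E_plus_E_minus algebra_simps)
    have "- const_op (-1) + const_op (1/2 * (1 + fst k)) = const_op (1/2 * (1 + (fst k + 2)))"
      unfolding const_op_hom(1,3) [symmetric] by (simp add: field_simps)
    then show "?e22"
      unfolding that commute_E_plus by (metis distrib_right minus_mult_left)
  qed
  ultimately show ?thesis
    unfolding * by blast
qed

text \<open>
  Mirror image of the previous lemma: the lower left entries agree identically, the upper left
  ones force \<open>c = -1\<close>, and the upper right ones reduce to \<open>E_minus_E_plus\<close>.
\<close>

lemma E_hat_minus_shift_iff: "is_shift_operator k (-2, 1) (E_hat_minus k c) \<longleftrightarrow> c = -1"
  (is "?shift \<longleftrightarrow> _")
proof -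
  have *: "?shift \<longleftrightarrow>
      E_minus (k_plus k) * const_op (1/2 * (1 - fst k)) - const_op c * E_minus (k_plus k)
        = const_op (1/2 * (1 - (fst k - 2))) * E_minus (k_plus k)
      \<and> - (E_minus (k_plus k) * E_plus (k_minus k)) + const_op c * const_op (1/2 * (1 + fst k))
        = const_op (1/2 * (1 - (fst k - 2))) * const_op c
          - E_plus (k_minus k + (-2, 1)) * E_minus (k_minus k)
      \<and> E_minus (k_minus k) * const_op (1/2 * (1 + fst k))
        = - (E_minus (k_minus k) * const_op c)
          + const_op (1/2 * (1 + (fst k - 2))) * E_minus (k_minus k)"
    (is "_ \<longleftrightarrow> ?e11 \<and> ?e12 \<and> ?e22")
    unfolding E_hat_minus_def
    by (subst is_shift_operator_mat2_iff)
       (simp_all add: admissible_0 admissible_const admissible_E_minus D_op_def mat2_mult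
         mat2_eq_iff k_plus_add k_minus_add k_plus_shift)
  have e11: "?e11 \<longleftrightarrow> c = -1"
  proof -
    have "?e11 \<longleftrightarrow> const_op (1/2 * (1 - fst k) - c) * E_minus (k_plus k)
        = const_op (1/2 * (1 - (fst k - 2))) * E_minus (k_plus k)"
      by (simp add: commute_E_minus const_op_hom(2) [of _ c] left_diff_distrib)
    also have "\<dots> \<longleftrightarrow> 1/2 * (1 - fst k) - c = 1/2 * (1 - (fst k - 2))"
      by (rule const_op_E_minus_cancel)
    also have "\<dots> \<longleftrightarrow> c = -1"
    proof -
      have "1/2 * (1 - (fst k - 2)) - (1/2 * (1 - fst k) - c) = c - (-1)"
        by (simp add: field_simps)
      then show ?thesis
        by (metis eq_iff_diff_eq_0)
    qed
    finally show ?thesis .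
  qed
  moreover have "?e12" "?e22" if "c = -1"
  proof -
    have "const_op (-1) * const_op (1/2 * (1 + fst k)) - const_op (1 - fst k)
        = const_op (1/2 * (1 - (fst k - 2))) * const_op (-1)"
      unfolding const_op_hom(2,4) [symmetric] by (simp add: field_simps)
    then show "?e12"
      by (simp add: that E_minus_E_plus algebra_simps)
    have "const_op (1/2 * (1 + fst k)) = - const_op (-1) + const_op (1/2 * (1 + (fst k - 2)))"
      unfolding const_op_hom(1,3) [symmetric] by (simp add: field_simps)
    then show "?e22"
      unfolding that commute_E_minus by (metis distrib_right minus_mult_left)
  qed
  ultimately show ?thesis
    unfolding * by blast
qed

theorem proposition3p3:
  fixes k :: "complex \<times> complex" and \<gamma>\<^sub>p \<gamma>\<^sub>m :: complex
  shows "is_shift_operator k (0, 1) (G_hat_plus k) \<and>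
         is_shift_operator k (0, -1) (G_hat_minus k) \<and>
         (is_shift_operator k (2, -1) (E_hat_plus k \<gamma>\<^sub>p) \<longleftrightarrow> \<gamma>\<^sub>p = -1) \<and>
         (is_shift_operator k (-2, 1) (E_hat_minus k \<gamma>\<^sub>m) \<longleftrightarrow> \<gamma>\<^sub>m = -1)"
  using G_hat_plus_shift G_hat_minus_shift E_hat_plus_shift_iff E_hat_minus_shift_iff by blast

end
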